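(* Let $A$ and $B$ be finitely generated residually finite groups and suppose that both $A$ and $B$ are inner automorphism separable (IAS). Then $A\times B$ is IAS and, consequently, $\operatorname{Out}(A\times B)$ is residually finite.
   Context: A group $G$ is inner automorphism separable (IAS) if for every $\phi \in \operatorname{Aut}(G)\setminus\operatorname{Inn}(G)$ there is a finite-index characteristic subgroup $K$ of $G$ such that $\tilde{\kappa}(\phi)\notin \operatorname{Inn}(G/K)$, where $\tilde{\kappa}\colon\operatorname{Aut}(G)\to\operatorname{Aut}(G/K)$ is given by $\tilde{\kappa}(\psi)(gK) = \psi(g)K$. Here $\operatorname{Out}(G) = \operatorname{Aut}(G)/\operatorname{Inn}(G)$. *)

theory Defs
  imports "HOL-Algebra.Bij" "HOL-Algebra.Generated_Groups"
begin

definition finitely_generated_group :: "('a, 'b) monoid_scheme \<Rightarrow> bool" where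
  "finitely_generated_group G \<longleftrightarrow>
     (\<exists>S. finite S \<and> S \<subseteq> carrier G \<and> generate G S = carrier G)"

definition finite_index :: "'a set \<Rightarrow> ('a, 'b) monoid_scheme \<Rightarrow> bool" where
  "finite_index H G \<longleftrightarrow> finite (rcosets\<^bsub>G\<^esub> H)"

definition residually_finite :: "('a, 'b) monoid_scheme \<Rightarrow> bool" where
  "residually_finite G \<longleftrightarrow>
     (\<forall>g\<in>carrier G. g \<noteq> \<one>\<^bsub>G\<^esub> \<longrightarrow> (\<exists>N. N \<lhd> G \<and> finite_index N G \<and> g \<notin> N))"

definition characteristic_subgroup :: "'a set \<Rightarrow> ('a, 'b) monoid_scheme \<Rightarrow> bool" where
  "characteristic_subgroup K G \<longleftrightarrow> subgroup K G \<and> (\<forall>\<phi>\<in>auto G. \<phi> ` K = K)"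

(* Elements of auto G are extensional functions on the carrier, hence the restriction
   of each conjugation to carrier G. *)
definition conj_by :: "('a, 'b) monoid_scheme \<Rightarrow> 'a \<Rightarrow> 'a \<Rightarrow> 'a" where
  "conj_by G g = (\<lambda>x\<in>carrier G. g \<otimes>\<^bsub>G\<^esub> x \<otimes>\<^bsub>G\<^esub> inv\<^bsub>G\<^esub> g)"

definition Inn :: "('a, 'b) monoid_scheme \<Rightarrow> ('a \<Rightarrow> 'a) set" where
  "Inn G = conj_by G ` carrier G"

definition Out :: "('a, 'b) monoid_scheme \<Rightarrow> ('a \<Rightarrow> 'a) set monoid" where
  "Out G = AutoGroup G Mod Inn G"

(* The map Aut(G) -> Aut(G/K) for characteristic K.  Cosets are sets, and the image of the
   coset gK under \<phi> is \<phi>(g)K; see induced_aut_l_coset and induced_aut_r_coset below. *)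
definition induced_aut ::
    "('a, 'b) monoid_scheme \<Rightarrow> 'a set \<Rightarrow> ('a \<Rightarrow> 'a) \<Rightarrow> 'a set \<Rightarrow> 'a set" where
  "induced_aut G K \<phi> = (\<lambda>X\<in>carrier (G Mod K). \<phi> ` X)"

definition inner_aut_separable :: "('a, 'b) monoid_scheme \<Rightarrow> bool" where
  "inner_aut_separable G \<longleftrightarrow>
     (\<forall>\<phi>\<in>auto G - Inn G.
        \<exists>K. characteristic_subgroup K G \<and> finite_index K G \<and>
            induced_aut G K \<phi> \<notin> Inn (G Mod K))"

context group
begin

lemma autoD:
  assumes "\<phi> \<in> auto G"
  shows "\<phi> \<in> hom G G" "bij_betw \<phi> (carrier G) (carrier G)" "\<phi> \<in> extensional (carrier G)"
  using assms by (auto simp: auto_def Bij_def)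

lemma conj_by_in_auto:
  assumes g: "g \<in> carrier G"
  shows "conj_by G g \<in> auto G"
proof -
  have cancel: "inv g \<otimes> (g \<otimes> y) = y" "g \<otimes> (inv g \<otimes> y) = y" if "y \<in> carrier G" for y
    using g that by (simp_all add: m_assoc [symmetric])
  have "conj_by G g \<in> hom G G"
    using g by (intro homI) (simp_all add: conj_by_def m_assoc cancel)
  moreover have "bij_betw (conj_by G g) (carrier G) (carrier G)"
    by (rule bij_betw_byWitness [where f' = "\<lambda>x. inv g \<otimes> x \<otimes> g"])
      (use g in \<open>auto simp: conj_by_def m_assoc cancel\<close>)
  ultimately show ?thesis
    by (simp add: auto_def Bij_def) (simp add: conj_by_def)
qed

lemma characteristic_imp_normal:
  assumes "characteristic_subgroup K G"
  shows "K \<lhd> G"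
  unfolding normal_inv_iff
proof (intro conjI ballI)
  show K: "subgroup K G"
    using assms by (simp add: characteristic_subgroup_def)
  fix x h assume x: "x \<in> carrier G" and h: "h \<in> K"
  have "conj_by G x ` K = K"
    using assms conj_by_in_auto [OF x] by (simp add: characteristic_subgroup_def)
  then have "conj_by G x h \<in> K"
    using h by blast
  then show "x \<otimes> h \<otimes> inv x \<in> K"
    using subgroup.mem_carrier [OF K h] by (simp add: conj_by_def)
qed

lemma
  assumes K: "characteristic_subgroup K G" and \<phi>: "\<phi> \<in> auto G" and g: "g \<in> carrier G"
  shows induced_aut_r_coset: "induced_aut G K \<phi> (K #> g) = K #> \<phi> g"
    and induced_aut_l_coset: "induced_aut G K \<phi> (g <# K) = \<phi> g <# K"
proof -
  have eq: "\<phi> ` K = K" and sub: "K \<subseteq> carrier G"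
    using K \<phi> by (auto simp: characteristic_subgroup_def subgroup.subset)
  have hom: "\<phi> (x \<otimes> y) = \<phi> x \<otimes> \<phi> y" if "x \<in> carrier G" "y \<in> carrier G" for x y
    using autoD(1) [OF \<phi>] that by (rule hom_mult)
  have "\<phi> ` (K #> g) = (\<lambda>k. \<phi> k \<otimes> \<phi> g) ` K"
    using sub g by (auto simp: r_coset_def hom image_iff subset_eq)
  also have "\<dots> = (\<lambda>k. k \<otimes> \<phi> g) ` (\<phi> ` K)"
    by (simp add: image_image)
  also have "\<dots> = K #> \<phi> g"
    by (auto simp: eq r_coset_def)
  finally show r: "induced_aut G K \<phi> (K #> g) = K #> \<phi> g"
    using g by (simp add: induced_aut_def carrier_FactGroup)
  have "\<phi> g \<in> carrier G"
    using autoD(1) [OF \<phi>] g by (rule hom_in_carrier)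
  then show "induced_aut G K \<phi> (g <# K) = \<phi> g <# K"
    using r g normal.coset_eq [OF characteristic_imp_normal [OF K]] by simp
qed

lemma induced_aut_in_auto:
  assumes K: "characteristic_subgroup K G" and \<phi>: "\<phi> \<in> auto G"
  shows "induced_aut G K \<phi> \<in> auto (G Mod K)"
proof -
  interpret normal K G by (rule characteristic_imp_normal [OF K])
  note r = induced_aut_r_coset [OF K \<phi>]
  have cl: "\<phi> x \<in> carrier G" if "x \<in> carrier G" for x
    using autoD(1) [OF \<phi>] that by (rule hom_in_carrier)
  have "induced_aut G K \<phi> \<in> hom (G Mod K) (G Mod K)"
    by (rule homI) (auto simp: carrier_FactGroup r cl rcos_sum hom_mult [OF autoD(1) [OF \<phi>]])
  moreover have "induced_aut G K \<phi> ` carrier (G Mod K) = carrier (G Mod K)"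
  proof -
    have "induced_aut G K \<phi> ` carrier (G Mod K) = (\<lambda>x. K #> x) ` (\<phi> ` carrier G)"
      by (force simp: carrier_FactGroup r image_iff)
    then show ?thesis
      using autoD(2) [OF \<phi>] by (simp add: bij_betw_def carrier_FactGroup)
  qed
  moreover have "inj_on (induced_aut G K \<phi>) (carrier (G Mod K))"
  proof (rule inj_onI)
    fix X Y assume XY: "X \<in> carrier (G Mod K)" "Y \<in> carrier (G Mod K)"
      and "induced_aut G K \<phi> X = induced_aut G K \<phi> Y"
    then have "\<phi> ` X = \<phi> ` Y" by (simp add: induced_aut_def)
    moreover have "X \<subseteq> carrier G" "Y \<subseteq> carrier G"
      using XY r_coset_subset_G [OF subset] by (auto simp: carrier_FactGroup)
    ultimately show "X = Y"
      using autoD(2) [OF \<phi>] by (auto simp: bij_betw_def inj_on_image_eq_iff)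
  qed
  ultimately show ?thesis
    by (simp add: auto_def Bij_def bij_betw_def) (simp add: induced_aut_def)
qed

lemma carrier_AutoGroup: "carrier (AutoGroup G) = auto G"
  by (simp add: AutoGroup_def)

lemma mult_AutoGroup:
  assumes "\<phi> \<in> auto G" "\<psi> \<in> auto G"
  shows "\<phi> \<otimes>\<^bsub>AutoGroup G\<^esub> \<psi> = compose (carrier G) \<phi> \<psi>"
  using assms by (simp add: AutoGroup_def BijGroup_def auto_def)

lemma conj_by_hom: "conj_by G \<in> hom G (AutoGroup G)"
proof (rule homI)
  fix x y assume "x \<in> carrier G" "y \<in> carrier G"
  then show "conj_by G (x \<otimes> y) = conj_by G x \<otimes>\<^bsub>AutoGroup G\<^esub> conj_by G y"
    by (simp add: mult_AutoGroup conj_by_in_auto)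
      (auto simp: fun_eq_iff compose_def conj_by_def m_assoc inv_mult_group)
qed (simp add: carrier_AutoGroup conj_by_in_auto)

lemma Inn_normal: "Inn G \<lhd> AutoGroup G"
proof -
  interpret A: group "AutoGroup G" by (rule AutoGroup)
  interpret c: group_hom G "AutoGroup G" "conj_by G"
    by unfold_locales (rule conj_by_hom)
  show ?thesis
    unfolding A.normal_inv_iff
  proof (intro conjI ballI)
    show "subgroup (Inn G) (AutoGroup G)"
      unfolding Inn_def by (rule c.img_is_subgroup)
    fix \<phi> \<psi> assume \<phi>: "\<phi> \<in> carrier (AutoGroup G)" and "\<psi> \<in> Inn G"
    then obtain g where g: "g \<in> carrier G" and \<psi>: "\<psi> = conj_by G g"
      by (auto simp: Inn_def)
    from \<phi> have \<phi>': "\<phi> \<in> auto G" by (simp add: carrier_AutoGroup)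
    interpret fh: group_hom G G \<phi>
      by unfold_locales (rule autoD(1) [OF \<phi>'])
    have "\<phi> \<otimes>\<^bsub>AutoGroup G\<^esub> conj_by G g = conj_by G (\<phi> g) \<otimes>\<^bsub>AutoGroup G\<^esub> \<phi>"
      using g \<phi>'
      by (simp add: mult_AutoGroup conj_by_in_auto)
        (auto simp: fun_eq_iff compose_def conj_by_def)
    then have "\<phi> \<otimes>\<^bsub>AutoGroup G\<^esub> \<psi> \<otimes>\<^bsub>AutoGroup G\<^esub> inv\<^bsub>AutoGroup G\<^esub> \<phi> = conj_by G (\<phi> g)"
      using \<phi> g by (simp add: \<psi> A.m_assoc)
    then show "\<phi> \<otimes>\<^bsub>AutoGroup G\<^esub> \<psi> \<otimes>\<^bsub>AutoGroup G\<^esub> inv\<^bsub>AutoGroup G\<^esub> \<phi> \<in> Inn G"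
      using g by (simp add: Inn_def)
  qed
qed

lemma group_Out: "group (Out G)"
  unfolding Out_def by (rule normal.factorgroup_is_group [OF Inn_normal])

end

end

theory Submission
  imports Defs
begin

text \<open>
  Let \<open>\<phi>\<close> be a non-inner automorphism of \<open>A \<times>\<times> B\<close>. If \<open>\<phi>\<close> moves an element of one factor out of
  that factor, residual finiteness of the other factor gives a finite quotient detecting this,
  whereas conjugations preserve both factors. Otherwise \<open>\<phi>\<close> is a product \<open>\<alpha> \<times> \<beta>\<close>, one of
  \<open>\<alpha>\<close>, \<open>\<beta>\<close> is not inner, and the finite quotient separating it from the inner automorphisms also
  serves for \<open>\<phi>\<close>. Finite generation allows shrinking the kernel of the detecting homomorphism to a
  characteristic subgroup of finite index.
\<close>

section \<open>Finite index and automorphisms: preliminaries\<close>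

context group
begin

text \<open>Equal values of \<open>f\<close> force equal cosets, so choosing one preimage for each
  value in the finite image already reaches every coset. The map is arbitrary: below it is once a
  homomorphism to a finite group, and once the tuple of all such homomorphisms.\<close>

lemma finite_index_if_separating_map:
  assumes K: "subgroup K G" and fin: "finite (f ` carrier G)"
    and sep: "\<And>x y. \<lbrakk>x \<in> carrier G; y \<in> carrier G; f x = f y\<rbrakk> \<Longrightarrow> x \<otimes> inv y \<in> K"
  shows "finite_index K G"
proof -
  have coset_eq: "K #> x = K #> y" if "x \<in> carrier G" "y \<in> carrier G" "f x = f y" for x y
  proof (rule coset_mult_inv1)
    show "K #> (x \<otimes> inv y) = K"
      using that by (intro coset_join2 K sep) auto
  qed (use that subgroup.subset [OF K] in auto)
  have "rcosets K \<subseteq> (\<lambda>t. K #> (SOME x. x \<in> carrier G \<and> f x = t)) ` f ` carrier G"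
  proof
    fix X assume "X \<in> rcosets K"
    then obtain x where x: "x \<in> carrier G" "X = K #> x"
      by (auto simp: RCOSETS_def)
    let ?y = "SOME y. y \<in> carrier G \<and> f y = f x"
    have "?y \<in> carrier G \<and> f ?y = f x"
      by (rule someI [where x = x]) (use x in simp)
    then have "X = K #> ?y"
      using x coset_eq [of x ?y] by simp
    then show "X \<in> (\<lambda>t. K #> (SOME x. x \<in> carrier G \<and> f x = t)) ` f ` carrier G"
      using x by blast
  qed
  then show ?thesis
    unfolding finite_index_def using fin by (meson finite_imageI finite_subset)
qed

lemma auto_group_hom:
  assumes "\<phi> \<in> auto G"
  shows "group_hom G G \<phi>"
  by unfold_locales (rule autoD(1) [OF assms])

lemma auto_inverse:
  assumes "\<phi> \<in> auto G"
  obtains \<psi> where "\<psi> \<in> auto G" "\<And>x. x \<in> carrier G \<Longrightarrow> \<phi> (\<psi> x) = x"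
proof
  have bij: "\<phi> \<in> Bij (carrier G)"
    using assms by (simp add: auto_def)
  show "restrict (inv_into (carrier G) \<phi>) (carrier G) \<in> auto G"
    using assms bij by (simp add: auto_def restrict_inv_into_hom restrict_inv_into_Bij)
  show "\<phi> (restrict (inv_into (carrier G) \<phi>) (carrier G) x) = x" if "x \<in> carrier G" for x
    using bij that by (simp add: Bij_def bij_betw_def f_inv_into_f)
qed

text \<open>Members of \<open>auto G\<close> are extensional, so they lie in the finite space of
  extensional functions from the carrier to itself.\<close>

lemma finite_auto:
  assumes "finite (carrier G)"
  shows "finite (auto G)"
proof (rule finite_subset)
  show "auto G \<subseteq> carrier G \<rightarrow>\<^sub>E carrier G"
    by (auto simp: auto_def hom_def Bij_def PiE_def)
  show "finite (carrier G \<rightarrow>\<^sub>E carrier G)"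
    using assms by (simp add: finite_PiE)
qed

end

lemma (in group_hom) finite_index_kernel:
  assumes "finite (carrier H)"
  shows "finite_index (kernel G H h) G"
proof (rule G.finite_index_if_separating_map)
  show "finite (h ` carrier G)"
    using assms by (rule finite_subset [rotated]) auto
qed (use subgroup_kernel in \<open>auto simp: kernel_def\<close>)

section \<open>Characteristic subgroups of finite index in finitely generated groups\<close>

lemma hom_eq_on_generate:
  assumes "group_hom G H f" "group_hom G H g" "S \<subseteq> carrier G"
    and eq: "\<And>s. s \<in> S \<Longrightarrow> f s = g s" and x: "x \<in> generate G S"
  shows "f x = g x"
proof -
  interpret f: group_hom G H f by fact
  interpret g: group_hom G H g by fact
  have mem: "y \<in> carrier G" if "y \<in> generate G S" for y
    using that assms(3) f.G.generate_incl by blast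
  show ?thesis
    using x by (induction rule: generate.induct) (use assms(3) mem in \<open>auto simp: eq\<close>)
qed

text \<open>A finitely generated group has only finitely many homomorphisms to a finite group; their
  common kernel is characteristic of finite index.\<close>

lemma (in group_hom) characteristic_subgroup_in_kernel:
  assumes fg: "finitely_generated_group G" and fin: "finite (carrier H)"
  obtains K where "characteristic_subgroup K G" "finite_index K G" "K \<subseteq> kernel G H h"
proof
  \<comment> \<open>Values outside the carrier are free in \<open>hom G H\<close>, so only its
    extensional members can be counted. The definition of \<open>K\<close> nevertheless ranges over
    all of \<open>hom G H\<close>, which is closed under composition with automorphisms of
    \<open>G\<close> without any restriction.\<close>
  define E where "E = hom G H \<inter> extensional (carrier G)"
  define K where "K = {x \<in> carrier G. \<forall>f\<in>hom G H. f x = \<one>\<^bsub>H\<^esub>}"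
  have gh: "group_hom G H f" if "f \<in> hom G H" for f
    using that by unfold_locales
  have restr: "restrict f (carrier G) \<in> E" if "f \<in> hom G H" for f
    using that by (auto simp: E_def hom_def)
  have K_sub: "subgroup K G"
  proof (rule G.subgroupI)
    fix x y assume xy: "x \<in> K" "y \<in> K"
    have "f (inv x) = \<one>\<^bsub>H\<^esub>" "f (x \<otimes> y) = \<one>\<^bsub>H\<^esub>" if f: "f \<in> hom G H" for f
    proof -
      interpret f: group_hom G H f by (rule gh [OF f])
      have mem: "x \<in> carrier G" "y \<in> carrier G" "f x = \<one>\<^bsub>H\<^esub>" "f y = \<one>\<^bsub>H\<^esub>"
        using xy f unfolding K_def by blast+
      show "f (inv x) = \<one>\<^bsub>H\<^esub>" "f (x \<otimes> y) = \<one>\<^bsub>H\<^esub>"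
        using mem by simp_all
    qed
    then show "inv x \<in> K" "x \<otimes> y \<in> K"
      using xy by (auto simp: K_def)
  next
    show "K \<noteq> {}"
      using group_hom.hom_one [OF gh] unfolding K_def by blast
  qed (auto simp: K_def)
  obtain S where S: "finite S" "S \<subseteq> carrier G" "generate G S = carrier G"
    using fg by (auto simp: finitely_generated_group_def)
  \<comment> \<open>A homomorphism is determined by its values on the finite generating set
    \<open>S\<close>, and these values lie in a finite group.\<close>
  have "finite E"
  proof (rule inj_on_finite)
    show "inj_on (\<lambda>f. restrict f S) E"
    proof (rule inj_onI)
      fix f g assume f: "f \<in> E" and g: "g \<in> E" and eq: "restrict f S = restrict g S"
      have eq_S: "f s = g s" if "s \<in> S" for s
        using fun_cong [OF eq, of s] that by simp
      have "f x = g x" if "x \<in> carrier G" for x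
        by (rule hom_eq_on_generate [OF gh gh S(2) eq_S])
          (use f g S(3) that in \<open>simp_all add: E_def\<close>)
      then show "f = g"
        using f g by (auto simp: E_def intro: extensionalityI)
    qed
    show "(\<lambda>f. restrict f S) ` E \<subseteq> S \<rightarrow>\<^sub>E carrier H"
      using S(2) by (force simp: E_def hom_def)
    show "finite (S \<rightarrow>\<^sub>E carrier H)"
      using S(1) fin by (simp add: finite_PiE)
  qed
  show "characteristic_subgroup K G"
    unfolding characteristic_subgroup_def
  proof (intro conjI ballI K_sub)
    \<comment> \<open>For a homomorphism \<open>f\<close> from \<open>G\<close> to \<open>H\<close>,
      the composite of \<open>f\<close> with \<phi> is again one, hence trivial on
      \<open>K\<close>.\<close>
    have image_le: "\<phi> ` K \<subseteq> K" if "\<phi> \<in> auto G" for \<phi>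
    proof
      fix y assume "y \<in> \<phi> ` K"
      then obtain x where x: "x \<in> K" "y = \<phi> x" by blast
      have \<phi>: "\<phi> \<in> hom G G"
        using that by (rule G.autoD(1))
      have "f (\<phi> x) = \<one>\<^bsub>H\<^esub>" if "f \<in> hom G H" for f
        using x(1) Group.hom_compose [OF \<phi> that] by (auto simp: K_def)
      then show "y \<in> K"
        using x hom_in_carrier [OF \<phi>] by (simp add: K_def)
    qed
    fix \<phi> assume \<phi>: "\<phi> \<in> auto G"
    from G.auto_inverse [OF \<phi>] obtain \<psi>
      where \<psi>: "\<psi> \<in> auto G" "\<And>x. x \<in> carrier G \<Longrightarrow> \<phi> (\<psi> x) = x"
      by blast
    \<comment> \<open>The reverse inclusion comes from the forward one for the inverse automorphism
      \<psi>.\<close>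
    have "K \<subseteq> \<phi> ` K"
    proof
      fix x assume x: "x \<in> K"
      then have "\<psi> x \<in> K" using image_le [OF \<psi>(1)] by blast
      moreover have "x = \<phi> (\<psi> x)" using \<psi>(2) x by (simp add: K_def)
      ultimately show "x \<in> \<phi> ` K" by blast
    qed
    then show "\<phi> ` K = K" using image_le [OF \<phi>] by blast
  qed
  show "finite_index K G"
  proof (rule G.finite_index_if_separating_map [OF K_sub])
    \<comment> \<open>The separating map sends \<open>x\<close> to the tuple of its images under all
      members of \<open>E\<close>; finiteness of \<open>E\<close> and \<open>H\<close> leaves
      finitely many tuples.\<close>
    show "finite ((\<lambda>x. \<lambda>f\<in>E. f x) ` carrier G)"
    proof (rule finite_subset)
      show "(\<lambda>x. \<lambda>f\<in>E. f x) ` carrier G \<subseteq> E \<rightarrow>\<^sub>E carrier H"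
        by (intro image_subsetI PiE_I) (auto simp: E_def intro: hom_in_carrier)
      show "finite (E \<rightarrow>\<^sub>E carrier H)"
        using \<open>finite E\<close> fin by (simp add: finite_PiE)
    qed
    fix x y assume xy: "x \<in> carrier G" "y \<in> carrier G" and eq: "(\<lambda>f\<in>E. f x) = (\<lambda>f\<in>E. f y)"
    have "f (x \<otimes> inv y) = \<one>\<^bsub>H\<^esub>" if f: "f \<in> hom G H" for f
    proof -
      interpret f: group_hom G H f by (rule gh [OF f])
      \<comment> \<open>On the carrier \<open>f\<close> agrees with its restriction, which is one of
        the coordinates of the tuple.\<close>
      have "f x = f y"
        using fun_cong [OF eq, of "restrict f (carrier G)"] restr [OF f] xy by simp
      then show ?thesis using xy by simp
    qed
    then show "x \<otimes> inv y \<in> K" using xy by (simp add: K_def)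
  qed
  show "K \<subseteq> kernel G H h"
    by (auto simp: K_def kernel_def homh)
qed

section \<open>Detecting non-inner automorphisms in finite quotients\<close>

text \<open>Since \<open>K\<close> lies in the kernel, \<open>h\<close> factors through
  \<open>G Mod K\<close>, and an equation with conjugation by \<open>K #> x\<close> there is carried
  to one with conjugation by \<open>h x\<close>. Separation can thus be tested in \<open>H\<close>,
  although the kernel of \<open>h\<close> need not be characteristic.\<close>

lemma (in group) induced_aut_inner_imp_conj:
  assumes K: "characteristic_subgroup K G" and \<phi>: "\<phi> \<in> auto G"
    and inner: "induced_aut G K \<phi> \<in> Inn (G Mod K)"
    and h: "group_hom G H h" and K_le: "K \<subseteq> kernel G H h"
  obtains x where "x \<in> carrier G"
    "\<And>g. g \<in> carrier G \<Longrightarrow> h (\<phi> g) = h x \<otimes>\<^bsub>H\<^esub> h g \<otimes>\<^bsub>H\<^esub> inv\<^bsub>H\<^esub> h x"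
proof -
  interpret K: normal K G by (rule characteristic_imp_normal [OF K])
  interpret Q: group "G Mod K" by (rule K.factorgroup_is_group)
  interpret h: group_hom G H h by (rule h)
  interpret q: group_hom G "G Mod K" "\<lambda>g. K #> g"
    by unfold_locales (rule K.r_coset_hom_Mod)
  obtain x where x: "x \<in> carrier G" and conj: "induced_aut G K \<phi> = conj_by (G Mod K) (K #> x)"
    using inner by (auto simp: Inn_def carrier_FactGroup)
  have "h (\<phi> g) = h x \<otimes>\<^bsub>H\<^esub> h g \<otimes>\<^bsub>H\<^esub> inv\<^bsub>H\<^esub> h x" if g: "g \<in> carrier G" for g
  proof -
    have \<phi>g: "\<phi> g \<in> carrier G"
      using autoD(1) [OF \<phi>] g by (rule hom_in_carrier)
    have "K #> \<phi> g = induced_aut G K \<phi> (K #> g)"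
      by (simp add: induced_aut_r_coset [OF K \<phi> g])
    also have "\<dots> = (K #> x) \<otimes>\<^bsub>G Mod K\<^esub> (K #> g) \<otimes>\<^bsub>G Mod K\<^esub> inv\<^bsub>G Mod K\<^esub> (K #> x)"
      using q.hom_closed [OF g] by (simp add: conj conj_by_def)
    also have "\<dots> = K #> (x \<otimes> g \<otimes> inv x)"
      using x g by (simp only: q.hom_mult q.hom_inv m_closed inv_closed)
    \<comment> \<open>Equal cosets mean that \<phi>\<open>g\<close> and the conjugate of
      \<open>g\<close> differ by an element of \<open>K\<close>, which \<open>h\<close>
      kills.\<close>
    finally have "\<phi> g \<in> K #> (x \<otimes> g \<otimes> inv x)"
      using rcos_self [OF \<phi>g K.subgroup_axioms] by simp
    then obtain k where k: "k \<in> K" "\<phi> g = k \<otimes> (x \<otimes> g \<otimes> inv x)"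
      by (auto simp: r_coset_def)
    then have "h k = \<one>\<^bsub>H\<^esub>" "k \<in> carrier G"
      using K_le by (auto simp: kernel_def)
    then show ?thesis using x g k by simp
  qed
  then show thesis using x that by blast
qed

text \<open>Residual finiteness supplies a finite quotient \<open>C Mod N\<close> in which
  \<open>p (\<phi> g)\<close> survives, while \<open>g\<close> becomes trivial there. A conjugate of
  the trivial element is trivial, so no inner automorphism can act like \<phi>.\<close>

lemma (in group) separated_if_not_preserving_kernel:
  assumes fg: "finitely_generated_group G" and C: "group_hom G C p" and rf: "residually_finite C"
    and \<phi>: "\<phi> \<in> auto G" and g: "g \<in> kernel G C p" and \<phi>g: "\<phi> g \<notin> kernel G C p"
  shows "\<exists>K. characteristic_subgroup K G \<and> finite_index K G \<and> induced_aut G K \<phi> \<notin> Inn (G Mod K)"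
proof -
  interpret p: group_hom G C p by (rule C)
  have g_in: "g \<in> carrier G" and pg: "p g = \<one>\<^bsub>C\<^esub>"
    using g by (auto simp: kernel_def)
  then have \<phi>g_in: "\<phi> g \<in> carrier G"
    using hom_in_carrier [OF autoD(1) [OF \<phi>]] by simp
  then have "p (\<phi> g) \<noteq> \<one>\<^bsub>C\<^esub>"
    using \<phi>g by (simp add: kernel_def)
  then obtain N where N: "N \<lhd> C" "finite_index N C" "p (\<phi> g) \<notin> N"
    using rf p.hom_closed [OF \<phi>g_in] unfolding residually_finite_def by blast
  interpret N: normal N C by (rule N)
  interpret Q: group "C Mod N" by (rule N.factorgroup_is_group)
  let ?h = "\<lambda>x. N #>\<^bsub>C\<^esub> p x"
  interpret h: group_hom G "C Mod N" ?h
    using Group.hom_compose [OF p.homh N.r_coset_hom_Mod] by unfold_locales (simp add: o_def)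
  have "finite (carrier (C Mod N))"
    using N(2) by (simp add: finite_index_def FactGroup_def)
  from h.characteristic_subgroup_in_kernel [OF fg this] obtain K
    where K: "characteristic_subgroup K G" "finite_index K G" "K \<subseteq> kernel G (C Mod N) ?h" .
  have "induced_aut G K \<phi> \<notin> Inn (G Mod K)"
  proof
    assume "induced_aut G K \<phi> \<in> Inn (G Mod K)"
    from induced_aut_inner_imp_conj [OF K(1) \<phi> this h.group_hom_axioms K(3)] obtain x
      where x: "x \<in> carrier G" and conj: "\<And>g. g \<in> carrier G \<Longrightarrow> ?h (\<phi> g) =
        ?h x \<otimes>\<^bsub>C Mod N\<^esub> ?h g \<otimes>\<^bsub>C Mod N\<^esub> inv\<^bsub>C Mod N\<^esub> ?h x"
      by blast
    note conj [OF g_in]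
    moreover have "?h g = \<one>\<^bsub>C Mod N\<^esub>"
      by (simp add: pg p.H.coset_mult_one N.subset)
    ultimately have "?h (\<phi> g) = \<one>\<^bsub>C Mod N\<^esub>"
      using h.hom_closed [OF x] by (simp only: Q.r_one Q.r_inv)
    then show False
      using N(3) p.hom_closed [OF \<phi>g_in] p.H.coset_join1 [OF _ _ N.subgroup_axioms] by simp
  qed
  with K show ?thesis by blast
qed

text \<open>If \<phi> induced conjugation by \<open>K #> x\<close> on \<open>G Mod K\<close>, then
  reading it on elements \<open>i c\<close> and projecting to \<open>C Mod N\<close> would make the
  map induced by \<alpha> conjugation by the coset of \<open>p x\<close>. Here \<open>N\<close> is
  chosen by separability of \<open>C\<close> precisely to exclude this.\<close>

lemma (in group) separated_if_retract_not_inner: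
  assumes fg: "finitely_generated_group G" and p: "group_hom G C p" and i: "group_hom C G i"
    and pi: "\<And>c. c \<in> carrier C \<Longrightarrow> p (i c) = c"
    and ias: "inner_aut_separable C"
    and \<phi>: "\<phi> \<in> auto G" and \<alpha>: "(\<lambda>c\<in>carrier C. p (\<phi> (i c))) \<in> auto C - Inn C"
  shows "\<exists>K. characteristic_subgroup K G \<and> finite_index K G \<and> induced_aut G K \<phi> \<notin> Inn (G Mod K)"
proof -
  interpret p: group_hom G C p by (rule p)
  interpret i: group_hom C G i by (rule i)
  let ?\<alpha> = "\<lambda>c\<in>carrier C. p (\<phi> (i c))"
  from ias \<alpha> obtain N where N: "characteristic_subgroup N C" "finite_index N C"
    and not_inner: "induced_aut C N ?\<alpha> \<notin> Inn (C Mod N)"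
    unfolding inner_aut_separable_def by blast
  interpret N: normal N C by (rule p.H.characteristic_imp_normal [OF N(1)])
  interpret Q: group "C Mod N" by (rule N.factorgroup_is_group)
  let ?h = "\<lambda>x. N #>\<^bsub>C\<^esub> p x"
  interpret h: group_hom G "C Mod N" ?h
    using Group.hom_compose [OF p.homh N.r_coset_hom_Mod] by unfold_locales (simp add: o_def)
  have "finite (carrier (C Mod N))"
    using N(2) by (simp add: finite_index_def FactGroup_def)
  from h.characteristic_subgroup_in_kernel [OF fg this] obtain K
    where K: "characteristic_subgroup K G" "finite_index K G" "K \<subseteq> kernel G (C Mod N) ?h" .
  have "induced_aut G K \<phi> \<notin> Inn (G Mod K)"
  proof
    assume "induced_aut G K \<phi> \<in> Inn (G Mod K)"
    from induced_aut_inner_imp_conj [OF K(1) \<phi> this h.group_hom_axioms K(3)] obtain x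
      where x: "x \<in> carrier G" and conj: "\<And>g. g \<in> carrier G \<Longrightarrow> ?h (\<phi> g) =
        ?h x \<otimes>\<^bsub>C Mod N\<^esub> ?h g \<otimes>\<^bsub>C Mod N\<^esub> inv\<^bsub>C Mod N\<^esub> ?h x"
      by blast
    \<comment> \<open>The equality is needed for every \<open>X\<close>: on cosets it follows from
      \<open>conj\<close>, and elsewhere both functions are \<open>undefined\<close>.\<close>
    have "induced_aut C N ?\<alpha> X = conj_by (C Mod N) (?h x) X" for X
    proof (cases "X \<in> carrier (C Mod N)")
      case True
      then obtain c where c: "c \<in> carrier C" "X = N #>\<^bsub>C\<^esub> c"
        by (auto simp: carrier_FactGroup)
      have "induced_aut C N ?\<alpha> X = ?h (\<phi> (i c))"
        using p.H.induced_aut_r_coset [OF N(1) _ c(1)] \<alpha> c by simp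
      also have "\<dots> = conj_by (C Mod N) (?h x) X"
        using conj [OF i.hom_closed [OF c(1)]] c True by (simp add: pi conj_by_def)
      finally show ?thesis .
    next
      case False
      then show ?thesis by (simp add: induced_aut_def conj_by_def)
    qed
    then have "induced_aut C N ?\<alpha> = conj_by (C Mod N) (?h x)" by blast
    then show False
      using not_inner h.hom_closed [OF x] by (simp add: Inn_def)
  qed
  with K show ?thesis by blast
qed

section \<open>Residual finiteness of the outer automorphism group\<close>

text \<open>Together with \<open>induced_aut_conj_by\<close>, this yields the homomorphism from
  \<open>Out G\<close> to \<open>Out (G Mod K)\<close>.\<close>

lemma (in group) induced_aut_hom:
  assumes K: "characteristic_subgroup K G"
  shows "induced_aut G K \<in> hom (AutoGroup G) (AutoGroup (G Mod K))"
proof (rule homI)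
  interpret K: normal K G by (rule characteristic_imp_normal [OF K])
  interpret Q: group "G Mod K" by (rule K.factorgroup_is_group)
  show "induced_aut G K \<phi> \<in> carrier (AutoGroup (G Mod K))"
    if "\<phi> \<in> carrier (AutoGroup G)" for \<phi>
    using that induced_aut_in_auto [OF K] by (simp add: carrier_AutoGroup Q.carrier_AutoGroup)
  fix \<phi> \<psi> assume "\<phi> \<in> carrier (AutoGroup G)" "\<psi> \<in> carrier (AutoGroup G)"
  then have \<phi>: "\<phi> \<in> auto G" and \<psi>: "\<psi> \<in> auto G" by (simp_all add: carrier_AutoGroup)
  interpret A: group "AutoGroup G" by (rule AutoGroup)
  have comp: "compose (carrier G) \<phi> \<psi> \<in> auto G"
    using A.m_closed [of \<phi> \<psi>] \<phi> \<psi> by (simp add: carrier_AutoGroup mult_AutoGroup)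
  have "induced_aut G K (compose (carrier G) \<phi> \<psi>) =
      compose (carrier (G Mod K)) (induced_aut G K \<phi>) (induced_aut G K \<psi>)"
  proof (rule extensionalityI [where A = "carrier (G Mod K)"])
    fix X assume X: "X \<in> carrier (G Mod K)"
    then obtain g where g: "g \<in> carrier G" "X = K #> g"
      by (auto simp: carrier_FactGroup)
    have "\<psi> g \<in> carrier G"
      using autoD(1) [OF \<psi>] g(1) by (rule hom_in_carrier)
    then show "induced_aut G K (compose (carrier G) \<phi> \<psi>) X =
        compose (carrier (G Mod K)) (induced_aut G K \<phi>) (induced_aut G K \<psi>) X"
      using X g by (simp add: compose_eq induced_aut_r_coset [OF K] comp \<phi> \<psi>)
  qed (simp_all add: induced_aut_def)
  then show "induced_aut G K (\<phi> \<otimes>\<^bsub>AutoGroup G\<^esub> \<psi>) =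
      induced_aut G K \<phi> \<otimes>\<^bsub>AutoGroup (G Mod K)\<^esub> induced_aut G K \<psi>"
    by (simp add: mult_AutoGroup Q.mult_AutoGroup \<phi> \<psi> induced_aut_in_auto [OF K])
qed

lemma (in group) induced_aut_conj_by:
  assumes K: "characteristic_subgroup K G" and g: "g \<in> carrier G"
  shows "induced_aut G K (conj_by G g) = conj_by (G Mod K) (K #> g)"
proof (rule extensionalityI [where A = "carrier (G Mod K)"])
  interpret K: normal K G by (rule characteristic_imp_normal [OF K])
  interpret Q: group "G Mod K" by (rule K.factorgroup_is_group)
  interpret q: group_hom G "G Mod K" "\<lambda>g. K #> g"
    by unfold_locales (rule K.r_coset_hom_Mod)
  fix X assume X: "X \<in> carrier (G Mod K)"
  then obtain x where x: "x \<in> carrier G" "X = K #> x"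
    by (auto simp: carrier_FactGroup)
  have "induced_aut G K (conj_by G g) X = K #> (g \<otimes> x \<otimes> inv g)"
    using induced_aut_r_coset [OF K conj_by_in_auto [OF g] x(1)] x by (simp add: conj_by_def)
  also have "\<dots> = (K #> g) \<otimes>\<^bsub>G Mod K\<^esub> X \<otimes>\<^bsub>G Mod K\<^esub> inv\<^bsub>G Mod K\<^esub> (K #> g)"
    using x g by (simp only: q.hom_mult q.hom_inv m_closed inv_closed)
  finally show "induced_aut G K (conj_by G g) X = conj_by (G Mod K) (K #> g) X"
    using X by (simp add: conj_by_def)
qed (simp_all add: induced_aut_def conj_by_def)

text \<open>The group \<open>Out G\<close> is separated by its maps to the finite groups \<open>Out (G Mod K)\<close>.\<close>

lemma (in group) residually_finite_Out:
  assumes "inner_aut_separable G"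
  shows "residually_finite (Out G)"
  unfolding residually_finite_def
proof (intro ballI impI)
  interpret A: group "AutoGroup G" by (rule AutoGroup)
  interpret I: normal "Inn G" "AutoGroup G" by (rule Inn_normal)
  interpret O: group "Out G" by (rule group_Out)
  fix X assume X: "X \<in> carrier (Out G)" "X \<noteq> \<one>\<^bsub>Out G\<^esub>"
  then obtain \<phi> where \<phi>: "\<phi> \<in> auto G" "X = Inn G #>\<^bsub>AutoGroup G\<^esub> \<phi>"
    by (auto simp: Out_def carrier_FactGroup carrier_AutoGroup)
  have "\<phi> \<notin> Inn G"
  proof
    assume "\<phi> \<in> Inn G"
    then have "X = Inn G"
      using \<phi> A.coset_join2 [OF _ I.subgroup_axioms] by (simp add: carrier_AutoGroup)
    with X show False by (simp add: Out_def)
  qed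
  with assms \<phi>(1) obtain K where K: "characteristic_subgroup K G" "finite_index K G"
    and not_inner: "induced_aut G K \<phi> \<notin> Inn (G Mod K)"
    unfolding inner_aut_separable_def by blast
  interpret K: normal K G by (rule characteristic_imp_normal [OF K(1)])
  interpret Q: group "G Mod K" by (rule K.factorgroup_is_group)
  interpret AQ: group "AutoGroup (G Mod K)" by (rule Q.AutoGroup)
  interpret IQ: normal "Inn (G Mod K)" "AutoGroup (G Mod K)" by (rule Q.Inn_normal)
  interpret OQ: group "Out (G Mod K)" by (rule Q.group_Out)
  let ?h = "\<lambda>\<psi>. Inn (G Mod K) #>\<^bsub>AutoGroup (G Mod K)\<^esub> induced_aut G K \<psi>"
  interpret h: group_hom "AutoGroup G" "Out (G Mod K)" ?h
    using Group.hom_compose [OF induced_aut_hom [OF K(1)] IQ.r_coset_hom_Mod]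
    by unfold_locales (simp add: o_def Out_def)
  \<comment> \<open>This identifies the kernel of \<open>?h\<close>. It serves twice: inner
    automorphisms are killed, and the chosen \<phi> is not.\<close>
  have h_one: "?h \<psi> = \<one>\<^bsub>Out (G Mod K)\<^esub> \<longleftrightarrow> induced_aut G K \<psi> \<in> Inn (G Mod K)"
    if "\<psi> \<in> auto G" for \<psi>
    using induced_aut_in_auto [OF K(1) that] AQ.coset_join1 [OF _ _ IQ.subgroup_axioms]
      AQ.coset_join2 [OF _ IQ.subgroup_axioms]
    by (auto simp: Out_def Q.carrier_AutoGroup)
  have h_Inn: "?h \<psi> = \<one>\<^bsub>Out (G Mod K)\<^esub>" if "\<psi> \<in> Inn G" for \<psi>
  proof -
    from that obtain g where g: "g \<in> carrier G" "\<psi> = conj_by G g"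
      by (auto simp: Inn_def)
    then have "induced_aut G K \<psi> \<in> Inn (G Mod K)"
      by (simp add: induced_aut_conj_by [OF K(1)] Inn_def carrier_FactGroup)
    then show ?thesis using h_one g conj_by_in_auto by simp
  qed
  \<comment> \<open>Constancy on cosets of \<open>Inn G\<close> is what lets \<open>?h\<close>
    descend to \<open>Out G\<close>: two representatives differ by an inner automorphism, which
    \<open>?h\<close> kills.\<close>
  have h_eq: "?h \<psi> = ?h \<chi>"
    if \<psi>: "\<psi> \<in> carrier (AutoGroup G)" and \<chi>: "\<chi> \<in> carrier (AutoGroup G)"
      and eq: "Inn G #>\<^bsub>AutoGroup G\<^esub> \<psi> = Inn G #>\<^bsub>AutoGroup G\<^esub> \<chi>" for \<psi> \<chi>
  proof -
    from eq have "\<psi> \<in> Inn G #>\<^bsub>AutoGroup G\<^esub> \<chi>"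
      using A.rcos_self [OF \<psi> I.subgroup_axioms] by simp
    then obtain \<iota> where "\<iota> \<in> Inn G" "\<psi> = \<iota> \<otimes>\<^bsub>AutoGroup G\<^esub> \<chi>"
      by (auto simp: r_coset_def)
    then have "?h \<psi> = \<one>\<^bsub>Out (G Mod K)\<^esub> \<otimes>\<^bsub>Out (G Mod K)\<^esub> ?h \<chi>"
      using h.hom_mult [OF I.mem_carrier \<chi>] h_Inn by simp
    then show "?h \<psi> = ?h \<chi>"
      using h.hom_closed [OF \<chi>] by (simp only: OQ.l_one)
  qed
  from FactGroup_universal [OF h.homh Inn_normal h_eq] obtain f
    where f: "f \<in> hom (Out G) (Out (G Mod K))"
    and f_eq: "\<And>\<psi>. \<psi> \<in> carrier (AutoGroup G) \<Longrightarrow> f (Inn G #>\<^bsub>AutoGroup G\<^esub> \<psi>) = ?h \<psi>"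
    unfolding Out_def by blast
  interpret f: group_hom "Out G" "Out (G Mod K)" f
    using f by unfold_locales
  \<comment> \<open>Finiteness passes from \<open>G Mod K\<close> to its automorphisms and then to
    their classes, so the kernel of \<open>f\<close> has finite index.\<close>
  have "finite (carrier (G Mod K))"
    using K(2) by (simp add: finite_index_def FactGroup_def)
  then have "finite (carrier (Out (G Mod K)))"
    using Q.finite_auto by (simp add: Out_def carrier_FactGroup Q.carrier_AutoGroup)
  then have "finite_index (kernel (Out G) (Out (G Mod K)) f) (Out G)"
    by (rule f.finite_index_kernel)
  moreover have "X \<notin> kernel (Out G) (Out (G Mod K)) f"
    using h_one [OF \<phi>(1)] not_inner f_eq \<phi> by (simp add: kernel_def carrier_AutoGroup)
  ultimately show "\<exists>N. N \<lhd> Out G \<and> finite_index N (Out G) \<and> X \<notin> N"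
    using f.normal_kernel by blast
qed

section \<open>Automorphisms of a direct product\<close>

locale group_pair = A: group A + B: group B
  for A :: "('a, 'c) monoid_scheme" and B :: "('b, 'd) monoid_scheme"
begin

sublocale P: group "A \<times>\<times> B"
  by (rule DirProd_group [OF A.is_group B.is_group])

sublocale fst: group_hom "A \<times>\<times> B" A fst
  by unfold_locales (auto simp: hom_def)

sublocale snd: group_hom "A \<times>\<times> B" B snd
  by unfold_locales (auto simp: hom_def)

text \<open>This and \<open>right_embedding\<close> are sections of \<open>fst\<close> and
  \<open>snd\<close>, so that each factor is a retract of the product.\<close>

lemma left_embedding: "group_hom A (A \<times>\<times> B) (\<lambda>a. (a, \<one>\<^bsub>B\<^esub>))"
  by unfold_locales (auto simp: hom_def)

lemma right_embedding: "group_hom B (A \<times>\<times> B) (\<lambda>b. (\<one>\<^bsub>A\<^esub>, b))"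
  by unfold_locales (auto simp: hom_def)

lemma finitely_generated_DirProd:
  assumes "finitely_generated_group A" "finitely_generated_group B"
  shows "finitely_generated_group (A \<times>\<times> B)"
proof -
  obtain S T where S: "finite S" "S \<subseteq> carrier A" "generate A S = carrier A"
    and T: "finite T" "T \<subseteq> carrier B" "generate B T = carrier B"
    using assms by (auto simp: finitely_generated_group_def)
  define U where "U = (\<lambda>a. (a, \<one>\<^bsub>B\<^esub>)) ` S \<union> (\<lambda>b. (\<one>\<^bsub>A\<^esub>, b)) ` T"
  have U: "finite U" "U \<subseteq> carrier (A \<times>\<times> B)"
    using S T by (auto simp: U_def)
  have "(\<lambda>a. (a, \<one>\<^bsub>B\<^esub>)) ` carrier A \<subseteq> generate (A \<times>\<times> B) U"
    using group_hom.generate_img [OF left_embedding S(2)] S(3) P.mono_generate by (metis U_def Un_upper1)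
  moreover have "(\<lambda>b. (\<one>\<^bsub>A\<^esub>, b)) ` carrier B \<subseteq> generate (A \<times>\<times> B) U"
    using group_hom.generate_img [OF right_embedding T(2)] T(3) P.mono_generate by (metis U_def Un_upper2)
  \<comment> \<open>Every pair \<open>(a, b)\<close> is the product of its two embedded
    components.\<close>
  ultimately have "(a, \<one>\<^bsub>B\<^esub>) \<otimes>\<^bsub>A \<times>\<times> B\<^esub> (\<one>\<^bsub>A\<^esub>, b) \<in> generate (A \<times>\<times> B) U"
    if "a \<in> carrier A" "b \<in> carrier B" for a b
    using that by (blast intro: generate.eng)
  then have "carrier (A \<times>\<times> B) \<subseteq> generate (A \<times>\<times> B) U"
    by auto
  then show ?thesis
    unfolding finitely_generated_group_def
    using U P.generate_incl [OF U(2)] by (intro exI [of _ U]) simp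
qed

text \<open>Outside the first two cases \<phi> maps each embedded factor into itself. Writing
  \<open>(a, b)\<close> as the product of \<open>(a, \<one>)\<close> and \<open>(\<one>, b)\<close>
  then splits \<phi> into components, and bijectivity of \<phi> passes to both.\<close>

lemma auto_DirProd_cases:
  assumes \<phi>: "\<phi> \<in> auto (A \<times>\<times> B)"
  obtains (left) a where "a \<in> carrier A" "snd (\<phi> (a, \<one>\<^bsub>B\<^esub>)) \<noteq> \<one>\<^bsub>B\<^esub>"
    | (right) b where "b \<in> carrier B" "fst (\<phi> (\<one>\<^bsub>A\<^esub>, b)) \<noteq> \<one>\<^bsub>A\<^esub>"
    | (product) \<alpha> \<beta> where "\<alpha> \<in> auto A" "\<beta> \<in> auto B"
        "\<And>a b. a \<in> carrier A \<Longrightarrow> b \<in> carrier B \<Longrightarrow> \<phi> (a, b) = (\<alpha> a, \<beta> b)"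
proof -
  interpret \<phi>: group_hom "A \<times>\<times> B" "A \<times>\<times> B" \<phi> by (rule P.auto_group_hom [OF \<phi>])
  have inj: "inj_on \<phi> (carrier A \<times> carrier B)"
    and surj: "\<phi> ` (carrier A \<times> carrier B) = carrier A \<times> carrier B"
    using P.autoD(2) [OF \<phi>] by (auto simp: bij_betw_def)
  define \<alpha> where "\<alpha> = (\<lambda>a\<in>carrier A. fst (\<phi> (a, \<one>\<^bsub>B\<^esub>)))"
  define \<beta> where "\<beta> = (\<lambda>b\<in>carrier B. snd (\<phi> (\<one>\<^bsub>A\<^esub>, b)))"
  consider (left) a where "a \<in> carrier A" "snd (\<phi> (a, \<one>\<^bsub>B\<^esub>)) \<noteq> \<one>\<^bsub>B\<^esub>"
    | (right) b where "b \<in> carrier B" "fst (\<phi> (\<one>\<^bsub>A\<^esub>, b)) \<noteq> \<one>\<^bsub>A\<^esub>"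
    | (product) "\<And>a. a \<in> carrier A \<Longrightarrow> snd (\<phi> (a, \<one>\<^bsub>B\<^esub>)) = \<one>\<^bsub>B\<^esub>"
        "\<And>b. b \<in> carrier B \<Longrightarrow> fst (\<phi> (\<one>\<^bsub>A\<^esub>, b)) = \<one>\<^bsub>A\<^esub>"
    by blast
  then show thesis
  proof cases
    case product
    have \<phi>1: "\<phi> (a, \<one>\<^bsub>B\<^esub>) = (\<alpha> a, \<one>\<^bsub>B\<^esub>)" if "a \<in> carrier A" for a
      using product(1) that by (simp add: \<alpha>_def prod_eq_iff)
    have \<phi>2: "\<phi> (\<one>\<^bsub>A\<^esub>, b) = (\<one>\<^bsub>A\<^esub>, \<beta> b)" if "b \<in> carrier B" for b
      using product(2) that by (simp add: \<beta>_def prod_eq_iff)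
    have \<alpha>_in: "\<alpha> a \<in> carrier A" if "a \<in> carrier A" for a
      using \<phi>.hom_closed [of "(a, \<one>\<^bsub>B\<^esub>)"] that by (simp add: \<phi>1)
    have \<beta>_in: "\<beta> b \<in> carrier B" if "b \<in> carrier B" for b
      using \<phi>.hom_closed [of "(\<one>\<^bsub>A\<^esub>, b)"] that by (simp add: \<phi>2)
    have \<phi>_eq: "\<phi> (a, b) = (\<alpha> a, \<beta> b)" if "a \<in> carrier A" "b \<in> carrier B" for a b
      using \<phi>.hom_mult [of "(a, \<one>\<^bsub>B\<^esub>)" "(\<one>\<^bsub>A\<^esub>, b)"] that by (simp add: \<phi>1 \<phi>2 \<alpha>_in \<beta>_in)
    have "\<alpha> \<in> hom A A"
    proof (rule homI)
      show "\<alpha> (x \<otimes>\<^bsub>A\<^esub> y) = \<alpha> x \<otimes>\<^bsub>A\<^esub> \<alpha> y" if "x \<in> carrier A" "y \<in> carrier A" for x y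
        using \<phi>.hom_mult [of "(x, \<one>\<^bsub>B\<^esub>)" "(y, \<one>\<^bsub>B\<^esub>)"] that by (simp add: \<phi>1)
    qed (rule \<alpha>_in)
    moreover have "inj_on \<alpha> (carrier A)"
    proof (rule inj_onI)
      fix x y assume "x \<in> carrier A" "y \<in> carrier A" "\<alpha> x = \<alpha> y"
      then show "x = y"
        using inj_onD [OF inj, of "(x, \<one>\<^bsub>B\<^esub>)" "(y, \<one>\<^bsub>B\<^esub>)"] by (simp add: \<phi>1)
    qed
    moreover have "\<alpha> ` carrier A = carrier A"
    proof (intro equalityI subsetI)
      show "x \<in> carrier A" if "x \<in> \<alpha> ` carrier A" for x
        using that \<alpha>_in by blast
      fix x assume "x \<in> carrier A"
      \<comment> \<open>The preimage is some pair \<open>(a, b)\<close> not assumed to lie in the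
        embedded factor; comparing first components still gives
        \<open>\<alpha> a = x\<close>.\<close>
      then have "(x, \<one>\<^bsub>B\<^esub>) \<in> \<phi> ` (carrier A \<times> carrier B)"
        by (simp add: surj)
      then show "x \<in> \<alpha> ` carrier A"
        by (auto simp: \<phi>_eq)
    qed
    ultimately have \<alpha>: "\<alpha> \<in> auto A"
      by (simp add: auto_def Bij_def bij_betw_def) (simp add: \<alpha>_def)
    have "\<beta> \<in> hom B B"
    proof (rule homI)
      show "\<beta> (x \<otimes>\<^bsub>B\<^esub> y) = \<beta> x \<otimes>\<^bsub>B\<^esub> \<beta> y" if "x \<in> carrier B" "y \<in> carrier B" for x y
        using \<phi>.hom_mult [of "(\<one>\<^bsub>A\<^esub>, x)" "(\<one>\<^bsub>A\<^esub>, y)"] that by (simp add: \<phi>2)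
    qed (rule \<beta>_in)
    moreover have "inj_on \<beta> (carrier B)"
    proof (rule inj_onI)
      fix x y assume "x \<in> carrier B" "y \<in> carrier B" "\<beta> x = \<beta> y"
      then show "x = y"
        using inj_onD [OF inj, of "(\<one>\<^bsub>A\<^esub>, x)" "(\<one>\<^bsub>A\<^esub>, y)"] by (simp add: \<phi>2)
    qed
    moreover have "\<beta> ` carrier B = carrier B"
    proof (intro equalityI subsetI)
      show "y \<in> carrier B" if "y \<in> \<beta> ` carrier B" for y
        using that \<beta>_in by blast
      fix y assume "y \<in> carrier B"
      then have "(\<one>\<^bsub>A\<^esub>, y) \<in> \<phi> ` (carrier A \<times> carrier B)"
        by (simp add: surj)
      then show "y \<in> \<beta> ` carrier B"
        by (auto simp: \<phi>_eq)
    qed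
    ultimately have "\<beta> \<in> auto B"
      by (simp add: auto_def Bij_def bij_betw_def) (simp add: \<beta>_def)
    from \<alpha> this \<phi>_eq show thesis by (intro that(3))
  next
    case left
    then show thesis by (rule that(1))
  next
    case right
    then show thesis by (rule that(2))
  qed
qed

lemma inner_aut_separable_DirProd:
  assumes A: "finitely_generated_group A" "residually_finite A" "inner_aut_separable A"
    and B: "finitely_generated_group B" "residually_finite B" "inner_aut_separable B"
  shows "inner_aut_separable (A \<times>\<times> B)"
  unfolding inner_aut_separable_def
proof
  let ?P = "A \<times>\<times> B"
  have fg: "finitely_generated_group ?P"
    by (intro finitely_generated_DirProd A B)
  fix \<phi> assume "\<phi> \<in> auto ?P - Inn ?P"
  then have \<phi>: "\<phi> \<in> auto ?P" and not_inner: "\<phi> \<notin> Inn ?P" by auto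
  from \<phi> show "\<exists>K. characteristic_subgroup K ?P \<and> finite_index K ?P \<and>
      induced_aut ?P K \<phi> \<notin> Inn (?P Mod K)"
  proof (cases rule: auto_DirProd_cases)
    \<comment> \<open>The embedded copy of \<open>A\<close> is the kernel of \<open>snd\<close>, so
      residual finiteness of \<open>B\<close> detects the element leaving it. The case
      \<open>right\<close> exchanges the factors.\<close>
    case (left a)
    then show ?thesis
      by (intro P.separated_if_not_preserving_kernel
            [OF fg snd.group_hom_axioms B(2) \<phi>, of "(a, \<one>\<^bsub>B\<^esub>)"]) (auto simp: kernel_def)
  next
    case (right b)
    then show ?thesis
      by (intro P.separated_if_not_preserving_kernel
            [OF fg fst.group_hom_axioms A(2) \<phi>, of "(\<one>\<^bsub>A\<^esub>, b)"]) (auto simp: kernel_def)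
  next
    case (product \<alpha> \<beta>)
    \<comment> \<open>The components are rewritten as embedding, then \<phi>, then projection, the
      form in which the retract criterion applies.\<close>
    have "\<alpha> = (\<lambda>a\<in>carrier A. fst (\<phi> (a, \<one>\<^bsub>B\<^esub>)))"
      using A.autoD(3) [OF product(1)] by (auto intro!: extensionalityI simp: product(3))
    moreover have "\<beta> = (\<lambda>b\<in>carrier B. snd (\<phi> (\<one>\<^bsub>A\<^esub>, b)))"
      using B.autoD(3) [OF product(2)] by (auto intro!: extensionalityI simp: product(3))
    \<comment> \<open>Conjugations by \<open>x\<close> and \<open>y\<close> in the factors would
      combine to conjugation by \<open>(x, y)\<close>, making \<phi> inner.\<close>
    moreover have "\<alpha> \<notin> Inn A \<or> \<beta> \<notin> Inn B"
    proof (rule ccontr)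
      assume "\<not> ?thesis"
      then obtain x y where xy: "x \<in> carrier A" "y \<in> carrier B"
        and eq: "\<alpha> = conj_by A x" "\<beta> = conj_by B y"
        by (auto simp: Inn_def)
      have "\<phi> = conj_by ?P (x, y)"
        using P.autoD(3) [OF \<phi>] xy A.is_group B.is_group
        by (intro extensionalityI [where A = "carrier ?P"])
          (auto simp: conj_by_def product(3) eq)
      then show False
        using not_inner xy by (simp add: Inn_def)
    qed
    ultimately consider "(\<lambda>a\<in>carrier A. fst (\<phi> (a, \<one>\<^bsub>B\<^esub>))) \<in> auto A - Inn A"
      | "(\<lambda>b\<in>carrier B. snd (\<phi> (\<one>\<^bsub>A\<^esub>, b))) \<in> auto B - Inn B"
      using product(1,2) by auto
    then show ?thesis
    proof cases
      case 1
      then show ?thesis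
        by (intro P.separated_if_retract_not_inner
              [OF fg fst.group_hom_axioms left_embedding _ A(3) \<phi>]) auto
    next
      case 2
      then show ?thesis
        by (intro P.separated_if_retract_not_inner
              [OF fg snd.group_hom_axioms right_embedding _ B(3) \<phi>]) auto
    qed
  qed
qed

end

theorem corollary2p6:
  fixes A :: "('a, 'c) monoid_scheme" and B :: "('b, 'd) monoid_scheme"
  assumes "group A" and "group B"
    and "finitely_generated_group A" and "finitely_generated_group B"
    and "residually_finite A" and "residually_finite B"
    and "inner_aut_separable A" and "inner_aut_separable B"
  shows "inner_aut_separable (A \<times>\<times> B) \<and> residually_finite (Out (A \<times>\<times> B))"
proof -
  interpret group_pair A B
    using assms by (simp add: group_pair_def)
  have "inner_aut_separable (A \<times>\<times> B)"
    using assms by (intro inner_aut_separable_DirProd)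
  then show ?thesis
    using P.residually_finite_Out by blast
qed

end
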